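(* Let $0<p<1$ and let $\{G_n : n\ge 1\}$ be the Superstar model with parameter $p$. For every integer $k\ge1$, with probability one, $$\lim_{n\to\infty}\frac1n\,\mathrm{card}\{1\le j\le n-1:\deg(v_j,G_n)=k\}=\nu_{\mathrm{SM}}(k,p),$$ where $\nu_{\mathrm{SM}}(\cdot,p)$ is the probability mass function on $\{1,2,\dots\}$ given by $$\nu_{\mathrm{SM}}(k,p)=\frac{2-p}{1-p}\,(k-1)!\prod_{i=1}^{k}\Bigl(i+\frac{2-p}{1-p}\Bigr)^{-1}.$$
   Context: Superstar model with parameter $p\in(0,1)$: a growing sequence of random trees $G_1,G_2,\dots$ constructed sequentially on one probability space. $G_1$ is the single vertex $v_0$ (the superstar). $G_2$ consists of $v_0$, a vertex $v_1$ and the edge between them. For $n\ge 2$, given $G_n$ (with vertex set $\{v_0,\dots,v_{n-1}\}$), $G_{n+1}$ is obtained by adding a new vertex $v_n$ and one edge: with probability $p$ the vertex $v_n$ is joined to $v_0$; with probability $1-p$ it is joined to one of the nonsuperstars $v_1,\dots,v_{n-1}$, where $v_i$ is chosen with probability proportional to its degree in $G_n$. $\deg(v,G)$ denotes the degree of vertex $v$ in the graph $G$. *)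

theory Defs
  imports "HOL-Probability.Probability"
begin

text \<open>A finite simple graph is given by its vertex set and its set of edges, an edge being the
  two-element set of its endpoints. The vertex \<open>v\<^sub>i\<close> of the model is the number \<open>i\<close>.\<close>

type_synonym graph = "nat set \<times> nat set set"

definition vertex_degree :: "nat \<Rightarrow> graph \<Rightarrow> nat" where
  "vertex_degree v g = card {e \<in> snd g. v \<in> e}"

definition attach :: "nat \<Rightarrow> nat \<Rightarrow> graph \<Rightarrow> graph" where
  "attach w u g = (insert w (fst g), insert {w, u} (snd g))"

text \<open>The transition probabilities are stated as elementary conditional probabilities given the
  events \<open>G n = g\<close> of positive probability. For each such \<open>g\<close> they add up to 1 over the possible
  neighbours \<open>0, \<dots>, n - 1\<close> of the new vertex \<open>n\<close>, so almost surely no other transition occurs and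
  \<open>G n\<close> determines \<open>G 1, \<dots>, G (n - 1)\<close>; conditioning on \<open>G n\<close> is thus the same as
  conditioning on the whole past. The value \<open>G 0\<close> is irrelevant.\<close>

locale superstar_model = prob_space M
  for M :: "'w measure" +
  fixes p :: real and G :: "nat \<Rightarrow> 'w \<Rightarrow> graph"
  assumes p_bounds: "0 < p" "p < 1"
    and G_measurable: "n \<ge> 1 \<Longrightarrow> G n \<in> measurable M (count_space UNIV)"
    and G_1: "\<omega> \<in> space M \<Longrightarrow> G 1 \<omega> = ({0}, {})"
    and G_2: "\<omega> \<in> space M \<Longrightarrow> G 2 \<omega> = ({0, 1}, {{0, 1}})"
    and attach_superstar:
      "n \<ge> 2 \<Longrightarrow> \<P>(\<omega> in M. G n \<omega> = g) > 0 \<Longrightarrow>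
        \<P>(\<omega> in M. G (Suc n) \<omega> = attach n 0 g \<bar> G n \<omega> = g) = p"
    and attach_nonsuperstar:
      "n \<ge> 2 \<Longrightarrow> \<P>(\<omega> in M. G n \<omega> = g) > 0 \<Longrightarrow> i \<in> {1..n - 1} \<Longrightarrow>
        \<P>(\<omega> in M. G (Suc n) \<omega> = attach n i g \<bar> G n \<omega> = g)
          = (1 - p) * (real (vertex_degree i g) / (\<Sum>j = 1..n - 1. real (vertex_degree j g)))"

definition nu_SM :: "nat \<Rightarrow> real \<Rightarrow> real" where
  "nu_SM k p = (2 - p) / (1 - p) * fact (k - 1) *
     (\<Prod>i = 1..k. inverse (real i + (2 - p) / (1 - p)))"

end

theory Submission
  imports Defs "HOL-Library.Discrete_Functions" "HOL-Real_Asymp.Real_Asymp"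
begin

text \<open>Let \<open>f\<close> be a statistic of the graph with bounded increments. Subtracting from \<open>f (G n)\<close> its
  conditional expected increments leaves a sum of bounded, pairwise orthogonal random variables, which
  is almost surely \<open>o(n)\<close> by a second moment bound along the squares. The sum \<open>S n\<close> of the degrees of
  the nonsuperstars has drift \<open>2 - p\<close>, so \<open>S n / n\<close> tends to \<open>2 - p\<close>. The number \<open>N k\<close> of nonsuperstars of
  degree \<open>k\<close> has drift \<open>[k = 1] + (1 - p) / S n * ((k - 1) * N (k - 1) - k * N k)\<close>, so up to \<open>o(n)\<close> it
  follows a linear recursion that forces \<open>N k / n\<close> to converge, by induction on \<open>k\<close>, to the solution of
  \<open>(2 - p) * \<nu> k = (2 - p) * [k = 1] + (1 - p) * ((k - 1) * \<nu> (k - 1) - k * \<nu> k)\<close>.\<close>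

section \<open>Averages of real sequences\<close>

text \<open>Once \<open>e\<close> stays below \<epsilon>/2, each step raises \<open>r\<close> by at
  most \<epsilon>/2, so \<open>r n\<close> is at most a constant plus \<epsilon>/2 times
  \<open>n\<close>; division by \<open>n\<close> removes the constant.\<close>

lemma almost_nonincreasing_over_n:
  fixes r e :: "nat \<Rightarrow> real"
  assumes nonneg: "\<And>n. 0 \<le> r n"
    and step: "\<forall>\<^sub>F n in sequentially. r (Suc n) \<le> r n + e n"
    and e: "e \<longlonglongrightarrow> 0"
  shows "(\<lambda>n. r n / real n) \<longlonglongrightarrow> 0"
proof (rule LIMSEQ_I)
  fix \<epsilon> :: real assume \<epsilon>: "0 < \<epsilon>"
  have "\<forall>\<^sub>F n in sequentially. e n < \<epsilon> / 2"
    using \<epsilon> by (intro order_tendstoD(2)[OF e]) simp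
  with step have "\<forall>\<^sub>F n in sequentially. r (Suc n) \<le> r n + \<epsilon> / 2"
    by eventually_elim auto
  then obtain N where N: "\<And>n. n \<ge> N \<Longrightarrow> r (Suc n) \<le> r n + \<epsilon> / 2"
    by (auto simp: eventually_sequentially)
  have bound: "r (N + m) \<le> r N + \<epsilon> / 2 * real m" for m
  proof (induction m)
    case (Suc m)
    then show ?case using N[of "N + m"] by (simp add: field_simps)
  qed simp
  have "(\<lambda>n. r N / real n) \<longlonglongrightarrow> 0"
    by (rule lim_const_over_n)
  then have "\<forall>\<^sub>F n in sequentially. r N / real n < \<epsilon> / 2"
    using \<epsilon> by (intro order_tendstoD(2)) auto
  then have "\<forall>\<^sub>F n in sequentially. norm (r n / real n - 0) < \<epsilon>"
    using eventually_ge_at_top[of "max N 1"]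
  proof eventually_elim
    case (elim n)
    then have n: "real n > 0" "n \<ge> N" by auto
    have "r n \<le> r N + \<epsilon> / 2 * real (n - N)"
      using bound[of "n - N"] n by simp
    also have "\<dots> \<le> r N + \<epsilon> / 2 * real n"
      using \<epsilon> by (intro add_left_mono mult_left_mono) auto
    finally have "r n / real n \<le> r N / real n + \<epsilon> / 2"
      using n by (simp add: field_simps)
    also have "\<dots> < \<epsilon>"
      using elim by linarith
    finally show ?case
      using nonneg[of n] by simp
  qed
  then show "\<exists>n0. \<forall>n\<ge>n0. norm (r n / real n - 0) < \<epsilon>"
    by (simp add: eventually_sequentially)
qed

text \<open>If \<open>x n\<close> grows like \<open>n * L\<close>, then \<open>c n * x n\<close> is
  close to \<beta> * L, so L = \<alpha> - \<beta> * L. Subtracting both \<open>n * L\<close> and the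
  accumulated noise turns the recursion into \<open>w (Suc n) = (1 - c n) * w n + e n\<close> with
  vanishing \<open>e\<close>. The noise \<open>d\<close> only has to vanish on average.\<close>

lemma perturbed_linear_recursion_limit:
  fixes x a c d :: "nat \<Rightarrow> real"
  assumes rec: "\<And>n. x (Suc n) = x n + a n - c n * x n + d n"
    and a: "a \<longlonglongrightarrow> \<alpha>"
    and c_nonneg: "\<And>n. 0 \<le> c n"
    and c: "(\<lambda>n. real n * c n) \<longlonglongrightarrow> \<beta>"
    and d: "(\<lambda>n. (\<Sum>i<n. d i) / real n) \<longlonglongrightarrow> 0"
  shows "(\<lambda>n. x n / real n) \<longlonglongrightarrow> \<alpha> / (1 + \<beta>)"
proof -
  define L where "L = \<alpha> / (1 + \<beta>)"
  define S where "S n = (\<Sum>i<n. d i)" for n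
  define w where "w n = x n - S n - real n * L" for n
  \<comment> \<open>The last term arises because the damping also acts on the removed noise; it is
    grouped so that both of its factors converge.\<close>
  define e where "e n = a n - L - real n * c n * L - (real n * c n) * (S n / real n)" for n
  have "\<beta> \<ge> 0"
    using c by (rule LIMSEQ_le_const) (auto intro!: exI[of _ 0] simp: c_nonneg)
  then have L: "\<alpha> - L - \<beta> * L - \<beta> * 0 = 0"
    by (simp add: L_def field_simps)
  have "e \<longlonglongrightarrow> \<alpha> - L - \<beta> * L - \<beta> * 0"
    unfolding e_def S_def by (intro tendsto_intros a c d)
  then have e: "e \<longlonglongrightarrow> 0" by (simp only: L)
  have w_rec: "w (Suc n) = (1 - c n) * w n + e n" for n
  proof -
    have "real n * c n * (S n / real n) = c n * S n"
      by (cases "n = 0") (auto simp: S_def)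
    moreover have "S (Suc n) = S n + d n"
      by (simp add: S_def)
    ultimately show ?thesis
      by (simp add: w_def e_def rec algebra_simps)
  qed
  \<comment> \<open>This says that \<open>c n\<close> tends to 0, so the factor
    \<open>1 - c n\<close> eventually lies in [0, 1] and cannot enlarge \<open>w\<close>.\<close>
  have "(\<lambda>n. real n * c n * inverse (real n)) \<longlonglongrightarrow> \<beta> * 0"
    by (intro tendsto_mult c lim_inverse_n)
  then have "\<forall>\<^sub>F n in sequentially. real n * c n * inverse (real n) < 1"
    by (intro order_tendstoD(2)) auto
  then have "\<forall>\<^sub>F n in sequentially. \<bar>w (Suc n)\<bar> \<le> \<bar>w n\<bar> + \<bar>e n\<bar>"
    using eventually_gt_at_top[of 0]
  proof eventually_elim
    case (elim n)
    then have "c n < 1" by (simp add: field_simps)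
    then have "\<bar>(1 - c n) * w n\<bar> \<le> 1 * \<bar>w n\<bar>"
      unfolding abs_mult using c_nonneg[of n] by (intro mult_right_mono) auto
    then show ?case using w_rec[of n] by linarith
  qed
  then have "(\<lambda>n. \<bar>w n\<bar> / real n) \<longlonglongrightarrow> 0"
    using e by (intro almost_nonincreasing_over_n[where e = "\<lambda>n. \<bar>e n\<bar>"] tendsto_rabs_zero) auto
  then have "(\<lambda>n. w n / real n) \<longlonglongrightarrow> 0"
    by (rule tendsto_rabs_zero_cancel[OF Lim_transform_eventually]) auto
  then have "(\<lambda>n. w n / real n + S n / real n + L) \<longlonglongrightarrow> 0 + 0 + L"
    unfolding S_def by (intro tendsto_intros d)
  moreover have "\<forall>\<^sub>F n in sequentially. w n / real n + S n / real n + L = x n / real n"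
    using eventually_gt_at_top[of 0] by eventually_elim (simp add: w_def field_simps)
  ultimately show ?thesis
    unfolding L_def by (simp add: tendsto_cong)
qed

text \<open>From the last square \<open>m\<^sup>2\<close> up to \<open>n\<close> there are at most
  \<open>2 * m\<close> steps, so \<open>s\<close> changes by at most \<open>2 * C * m\<close>, which
  is negligible against \<open>m\<^sup>2\<close>.\<close>

lemma lipschitz_over_n_limit_of_squares:
  fixes s :: "nat \<Rightarrow> real"
  assumes lip: "\<And>n. \<bar>s (Suc n) - s n\<bar> \<le> C"
    and squares: "(\<lambda>m. s (m\<^sup>2) / real (m\<^sup>2)) \<longlonglongrightarrow> 0"
  shows "(\<lambda>n. s n / real n) \<longlonglongrightarrow> 0"
proof (rule Lim_null_comparison)
  have sqrt_lim: "filterlim floor_sqrt sequentially sequentially"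
    unfolding filterlim_at_top
  proof
    fix Z :: nat
    show "\<forall>\<^sub>F x in sequentially. Z \<le> floor_sqrt x"
      using eventually_ge_at_top[of "Z\<^sup>2"]
      by eventually_elim (metis floor_sqrt_inverse_power2 mono_floor_sqrt')
  qed
  let ?bound = "\<lambda>m. \<bar>s (m\<^sup>2) / real (m\<^sup>2)\<bar> + 2 * C * inverse (real m)"
  have "?bound \<longlonglongrightarrow> 0 + 2 * C * 0"
    by (intro tendsto_intros tendsto_rabs_zero squares lim_inverse_n)
  then show "(\<lambda>n. ?bound (floor_sqrt n)) \<longlonglongrightarrow> 0"
    using filterlim_compose[OF _ sqrt_lim] by simp
  have dist: "\<bar>s (n + i) - s n\<bar> \<le> C * real i" for n i
  proof (induction i)
    case (Suc i)
    then show ?case using lip[of "n + i"] by (simp add: algebra_simps)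
  qed simp
  have C: "0 \<le> C" using lip[of 0] by linarith
  show "\<forall>\<^sub>F n in sequentially. norm (s n / real n) \<le> ?bound (floor_sqrt n)"
    using eventually_gt_at_top[of 0]
  proof eventually_elim
    case (elim n)
    define m where "m = floor_sqrt n"
    have m: "m\<^sup>2 \<le> n" "n < (Suc m)\<^sup>2" "0 < m"
      using elim Suc_floor_sqrt_power2_gt[of n] by (auto simp: m_def)
    have "\<bar>s n - s (m\<^sup>2)\<bar> \<le> C * real (n - m\<^sup>2)"
      using dist[of "m\<^sup>2" "n - m\<^sup>2"] m by simp
    also have "\<dots> \<le> C * (2 * real m)"
    proof -
      have "n - m\<^sup>2 \<le> 2 * m" using m by (simp add: power2_eq_square)
      then have "real (n - m\<^sup>2) \<le> 2 * real m" by linarith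
      then show ?thesis using C by (intro mult_left_mono)
    qed
    finally have "\<bar>s n\<bar> \<le> \<bar>s (m\<^sup>2)\<bar> + 2 * C * real m" by linarith
    moreover have "real (m\<^sup>2) \<le> real n" using m by linarith
    ultimately have "\<bar>s n\<bar> / real n \<le> (\<bar>s (m\<^sup>2)\<bar> + 2 * C * real m) / real (m\<^sup>2)"
      using m C by (intro frac_le) auto
    also have "\<dots> = ?bound m"
      using m by (simp add: field_simps power2_eq_square abs_divide)
    finally show ?case by (simp add: m_def abs_divide)
  qed
qed

section \<open>A strong law for bounded orthogonal random variables\<close>

text \<open>Exchanging sum and integral shows that the random series has finite expectation. Hence
  it converges almost everywhere and its terms vanish.\<close>

lemma nn_integral_summable_imp_AE_tendsto_0:
  fixes X :: "nat \<Rightarrow> 'a \<Rightarrow> real"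
  assumes [measurable]: "\<And>n. X n \<in> borel_measurable M"
    and nonneg: "\<And>n x. 0 \<le> X n x"
    and int: "\<And>n. integrable M (X n)"
    and summable: "summable (\<lambda>n. \<integral>x. X n x \<partial>M)"
  shows "AE x in M. (\<lambda>n. X n x) \<longlonglongrightarrow> 0"
proof -
  have "(\<integral>\<^sup>+ x. (\<Sum>n. ennreal (X n x)) \<partial>M) = (\<Sum>n. \<integral>\<^sup>+ x. ennreal (X n x) \<partial>M)"
    by (intro nn_integral_suminf) auto
  also have "\<dots> = (\<Sum>n. ennreal (\<integral>x. X n x \<partial>M))"
    by (intro suminf_cong nn_integral_eq_integral int) (auto simp: nonneg)
  also have "\<dots> = ennreal (\<Sum>n. \<integral>x. X n x \<partial>M)"
    by (intro suminf_ennreal2 summable) (auto simp: nonneg)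
  finally have "(\<integral>\<^sup>+ x. (\<Sum>n. ennreal (X n x)) \<partial>M) \<noteq> \<infinity>" by simp
  then have "AE x in M. (\<Sum>n. ennreal (X n x)) \<noteq> \<infinity>"
    by (intro nn_integral_PInf_AE) auto
  then show ?thesis
  proof eventually_elim
    case (elim x)
    then have "summable (\<lambda>n. X n x)"
      by (intro summable_suminf_not_top) (auto simp: nonneg)
    then show ?case by (rule summable_LIMSEQ_zero)
  qed
qed

text \<open>Without cross terms the second moment of the \<open>n\<close>-th partial sum is at most
  \<open>n * C\<^sup>2\<close>. The averages at the times \<open>m\<^sup>2\<close> therefore have
  second moments at most \<open>C\<^sup>2 / m\<^sup>2\<close>, which are summable, and boundedness
  fills the gaps between squares.\<close>

lemma (in prob_space) slln_bounded_orthogonal: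
  fixes X :: "nat \<Rightarrow> 'a \<Rightarrow> real"
  assumes [measurable]: "\<And>n. X n \<in> borel_measurable M"
    and bounded: "\<And>n. AE x in M. \<bar>X n x\<bar> \<le> C"
    and orthogonal: "\<And>i j. i < j \<Longrightarrow> expectation (\<lambda>x. X i x * X j x) = 0"
  shows "AE x in M. (\<lambda>n. (\<Sum>i<n. X i x) / real n) \<longlonglongrightarrow> 0"
proof -
  have int [simp]: "integrable M (\<lambda>x. X i x * X j x)" for i j
  proof (rule integrable_const_bound[where B = "C * C"])
    show "AE x in M. norm (X i x * X j x) \<le> C * C"
      using bounded[of i] bounded[of j]
      by eventually_elim (auto simp: abs_mult intro!: mult_mono)
  qed auto
  have second_moment: "expectation (\<lambda>x. (\<Sum>i<n. X i x)\<^sup>2) \<le> real n * (C * C)" for n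
  proof -
    have "expectation (\<lambda>x. (\<Sum>i<n. X i x)\<^sup>2) = (\<Sum>i<n. \<Sum>j<n. expectation (\<lambda>x. X i x * X j x))"
      by (simp add: power2_eq_square sum_product)
    also have "\<dots> = (\<Sum>i<n. expectation (\<lambda>x. X i x * X i x))"
    proof (rule sum.cong[OF refl])
      fix i assume i: "i \<in> {..<n}"
      have "expectation (\<lambda>x. X i x * X j x) = 0" if "j \<noteq> i" for j
        using orthogonal[of i j] orthogonal[of j i] that by (auto simp: mult.commute neq_iff)
      then show "(\<Sum>j<n. expectation (\<lambda>x. X i x * X j x)) = expectation (\<lambda>x. X i x * X i x)"
        using i by (subst sum.remove[of _ i]) auto
    qed
    also have "\<dots> \<le> (\<Sum>i<n. C * C)"
    proof (rule sum_mono)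
      fix i
      have "AE x in M. X i x * X i x \<le> C * C"
        using bounded[of i]
      proof eventually_elim
        case (elim x)
        show ?case using mult_mono'[OF elim elim] by simp
      qed
      then show "expectation (\<lambda>x. X i x * X i x) \<le> C * C"
        using integral_mono_AE[of M "\<lambda>x. X i x * X i x" "\<lambda>_. C * C"] by (simp add: prob_space)
    qed
    finally show ?thesis by simp
  qed
  let ?Y = "\<lambda>m x. ((\<Sum>i<m\<^sup>2. X i x) / real (m\<^sup>2))\<^sup>2"
  have int_Y: "integrable M (?Y m)" for m
    by (simp add: power_divide power2_eq_square sum_product)
  have "AE x in M. (\<lambda>m. ?Y m x) \<longlonglongrightarrow> 0"
  proof (rule nn_integral_summable_imp_AE_tendsto_0)
    have "norm (expectation (?Y m)) \<le> C * C * inverse (real m ^ 2)" for m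
    proof -
      have "expectation (?Y m) = expectation (\<lambda>x. (\<Sum>i<m\<^sup>2. X i x)\<^sup>2) / (real (m\<^sup>2))\<^sup>2"
        by (simp add: power_divide)
      also have "\<dots> \<le> real (m\<^sup>2) * (C * C) / (real (m\<^sup>2))\<^sup>2"
        by (intro divide_right_mono second_moment) auto
      \<comment> \<open>For \<open>m = 0\<close> both sides are 0, since division by 0 gives
        0.\<close>
      also have "\<dots> = C * C * inverse (real m ^ 2)"
        by (simp add: power2_eq_square field_simps)
      finally show ?thesis by simp
    qed
    then show "summable (\<lambda>m. expectation (?Y m))"
      by (intro summable_comparison_test'[OF summable_mult[OF inverse_power_summable[of 2]]]) auto
  qed (use int_Y in auto)
  moreover have "AE x in M. \<forall>n. \<bar>X n x\<bar> \<le> C"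
    using bounded by (simp add: AE_all_countable)
  ultimately show ?thesis
  proof eventually_elim
    case (elim x)
    have "(\<lambda>m. (\<Sum>i<m\<^sup>2. X i x) / real (m\<^sup>2)) \<longlonglongrightarrow> 0"
      using tendsto_real_sqrt[OF elim(1)] by (simp only: real_sqrt_zero real_sqrt_abs tendsto_rabs_zero_iff)
    then show ?case
      using elim(2) by (intro lipschitz_over_n_limit_of_squares[where C = C]) auto
  qed
qed

section \<open>Degrees under attachment\<close>

text \<open>Indices are shifted by two: \<open>reachable m\<close> contains the possible values of \<open>G (m + 2)\<close>, whose
  nonsuperstars are the elements of \<open>{0<..<m + 2}\<close> and to which the vertex \<open>m + 2\<close> is attached next.\<close>

primrec reachable :: "nat \<Rightarrow> graph set" where
  "reachable 0 = {({0, 1}, {{0, 1}})}"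
| "reachable (Suc m) = (\<Union>i<m + 2. attach (m + 2) i ` reachable m)"

lemma reachable_attach: "g \<in> reachable m \<Longrightarrow> i < m + 2 \<Longrightarrow> attach (m + 2) i g \<in> reachable (Suc m)"
  by auto

lemma finite_reachable: "finite (reachable m)"
  by (induction m) auto

text \<open>Makes \<open>m + 2\<close> a fresh vertex for every graph in \<open>reachable m\<close>,
  and keeps the edge sets finite so that \<open>card\<close> counts degrees correctly.\<close>

lemma reachable_wellformed:
  "g \<in> reachable m \<Longrightarrow> fst g = {..<m + 2} \<and> finite (snd g) \<and> (\<forall>e\<in>snd g. e \<subseteq> {..<m + 2})"
proof (induction m arbitrary: g)
  case (Suc m)
  then obtain i h where i: "i < m + 2" and h: "h \<in> reachable m" and g: "g = attach (m + 2) i h"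
    by auto
  show ?case
    using Suc.IH[OF h] i unfolding g attach_def by fastforce
qed auto

lemma new_edge_notin:
  assumes "g \<in> reachable m"
  shows "{m + 2, i} \<notin> snd g"
  using reachable_wellformed[OF assms] by fastforce

lemma vertex_degree_outside:
  assumes "g \<in> reachable m" "m + 2 \<le> j"
  shows "vertex_degree j g = 0"
proof -
  have "{e \<in> snd g. j \<in> e} = {}"
    using reachable_wellformed[OF assms(1)] assms(2) by fastforce
  then show ?thesis by (simp only: vertex_degree_def card.empty)
qed

lemma vertex_degree_attach:
  assumes g: "g \<in> reachable m"
  shows "vertex_degree j (attach (m + 2) i g) = vertex_degree j g + of_bool (j = m + 2 \<or> j = i)"
proof -
  have "{e \<in> snd (attach (m + 2) i g). j \<in> e} =
      (if j = m + 2 \<or> j = i then insert {m + 2, i} {e \<in> snd g. j \<in> e} else {e \<in> snd g. j \<in> e})"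
    by (auto simp: attach_def)
  then show ?thesis
    using reachable_wellformed[OF g] new_edge_notin[OF g] by (simp add: vertex_degree_def)
qed

text \<open>The new edge is not in \<open>g\<close>, so equal edge sets force equal new edges.
  Different choices of the neighbour thus give disjoint events.\<close>

lemma attach_inj:
  assumes "g \<in> reachable m" "i < m + 2" "j < m + 2" "attach (m + 2) i g = attach (m + 2) j g"
  shows "i = j"
proof -
  have "{m + 2, i} = {m + 2, j}"
    using assms new_edge_notin[OF assms(1)] by (auto simp: attach_def)
  then show ?thesis
    using assms by (auto simp: doubleton_eq_iff)
qed

text \<open>Undoes an attachment: no old edge meets the newest vertex. This is how the current graph
  reveals its predecessors.\<close>

definition detach :: "nat \<Rightarrow> graph \<Rightarrow> graph" where
  "detach w g = (fst g - {w}, {e \<in> snd g. w \<notin> e})"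

lemma detach_attach:
  assumes "g \<in> reachable m"
  shows "detach (m + 2) (attach (m + 2) i g) = g"
  using reachable_wellformed[OF assms] by (cases g) (fastforce simp: detach_def attach_def)

section \<open>Degree statistics of the nonsuperstars and their one-step changes\<close>

definition degree_sum :: "nat \<Rightarrow> graph \<Rightarrow> real" where
  "degree_sum m g = (\<Sum>j\<in>{0<..<m + 2}. real (vertex_degree j g))"

definition degree_count :: "nat \<Rightarrow> nat \<Rightarrow> graph \<Rightarrow> real" where
  "degree_count k m g = (\<Sum>j\<in>{0<..<m + 2}. of_bool (vertex_degree j g = k))"

lemma degree_count_eq_card:
  "degree_count k m g = real (card {j. 1 \<le> j \<and> j \<le> m + 1 \<and> vertex_degree j g = k})"
proof -
  have "{j. 1 \<le> j \<and> j \<le> m + 1 \<and> vertex_degree j g = k} = {0<..<m + 2} \<inter> {j. vertex_degree j g = k}"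
    by auto
  then show ?thesis
    by (simp add: degree_count_def del: card.empty)
qed

lemma nonsuperstars_Suc: "{0<..<Suc m + 2} = insert (m + 2) {0<..<m + 2}"
  by auto

text \<open>The new leaf contributes 1; its neighbour contributes another 1 unless it is the
  superstar, whose degree is not counted.\<close>

lemma degree_sum_attach:
  assumes g: "g \<in> reachable m" and i: "i < m + 2"
  shows "degree_sum (Suc m) (attach (m + 2) i g) - degree_sum m g = (if i = 0 then 1 else 2)"
proof -
  let ?d = "\<lambda>j. vertex_degree j g"
  have "degree_sum (Suc m) (attach (m + 2) i g) =
      1 + (\<Sum>j\<in>{0<..<m + 2}. real (vertex_degree j (attach (m + 2) i g)))"
    unfolding degree_sum_def nonsuperstars_Suc
    using vertex_degree_outside[OF g, of "m + 2"] by (simp add: vertex_degree_attach[OF g, simplified])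
  also have "(\<Sum>j\<in>{0<..<m + 2}. real (vertex_degree j (attach (m + 2) i g))) =
      (\<Sum>j\<in>{0<..<m + 2}. real (?d j) + (if j = i then 1 else 0))"
    by (intro sum.cong refl) (simp add: vertex_degree_attach[OF g, simplified])
  also have "\<dots> = degree_sum m g + (if i = 0 then 0 else 1)"
    using i by (simp add: sum.distrib degree_sum_def)
  finally show ?thesis by simp
qed

lemma degree_sum_pos: "g \<in> reachable m \<Longrightarrow> 0 < degree_sum m g"
proof (induction m arbitrary: g)
  case 0
  have "{e. e = {0, Suc 0} \<and> Suc 0 \<in> e} = {{0, Suc 0}}" "{0<..<Suc (Suc 0)} = {Suc 0}" by auto
  then show ?case using 0 by (simp add: degree_sum_def vertex_degree_def)
next
  case (Suc m)
  then obtain i h where i: "i < m + 2" and h: "h \<in> reachable m" and g: "g = attach (m + 2) i h"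
    by auto
  then show ?case
    using degree_sum_attach[OF h i] Suc.IH[OF h] by (auto split: if_splits)
qed

text \<open>The new leaf enters class 1, and a nonsuperstar neighbour moves from its degree class to
  the next one.\<close>

lemma degree_count_attach:
  assumes g: "g \<in> reachable m" and i: "i < m + 2"
  shows "degree_count k (Suc m) (attach (m + 2) i g) - degree_count k m g = of_bool (k = 1) +
    (if i = 0 then 0 else of_bool (vertex_degree i g + 1 = k) - of_bool (vertex_degree i g = k))"
proof -
  let ?d = "\<lambda>j. vertex_degree j g"
  let ?c = "of_bool (?d i + 1 = k) - of_bool (?d i = k) :: real"
  have "degree_count k (Suc m) (attach (m + 2) i g) = of_bool (k = 1) +
      (\<Sum>j\<in>{0<..<m + 2}. of_bool (vertex_degree j (attach (m + 2) i g) = k))"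
  proof -
    have "vertex_degree (m + 2) (attach (m + 2) i g) = 1"
      using vertex_degree_outside[OF g, of "m + 2"] by (simp add: vertex_degree_attach[OF g, simplified])
    then show ?thesis
      unfolding degree_count_def nonsuperstars_Suc by (subst sum.insert) auto
  qed
  also have "(\<Sum>j\<in>{0<..<m + 2}. of_bool (vertex_degree j (attach (m + 2) i g) = k)) =
      (\<Sum>j\<in>{0<..<m + 2}. of_bool (?d j = k) + (if j = i then ?c else 0))"
    by (intro sum.cong refl) (auto simp: vertex_degree_attach[OF g, simplified])
  also have "\<dots> = degree_count k m g + (if i = 0 then 0 else ?c)"
    using i by (simp only: sum.distrib degree_count_def sum.delta' finite_greaterThanLessThan) auto
  finally show ?thesis by simp
qed

section \<open>One-step transition law and drifts\<close>

definition transition_prob :: "real \<Rightarrow> nat \<Rightarrow> graph \<Rightarrow> nat \<Rightarrow> real" where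
  "transition_prob p m g i = (if i = 0 then p else (1 - p) * (real (vertex_degree i g) / degree_sum m g))"

lemma sum_transition_prob_mult:
  "(\<Sum>i<m + 2. transition_prob p m g i * F i) =
    p * F 0 + (1 - p) / degree_sum m g * (\<Sum>i\<in>{0<..<m + 2}. real (vertex_degree i g) * F i)"
proof -
  have "{..<m + 2} = insert 0 {0<..<m + 2}" by auto
  then have "(\<Sum>i<m + 2. transition_prob p m g i * F i) =
      p * F 0 + (\<Sum>i\<in>{0<..<m + 2}. transition_prob p m g i * F i)"
    by (simp add: transition_prob_def)
  also have "(\<Sum>i\<in>{0<..<m + 2}. transition_prob p m g i * F i) =
      (1 - p) / degree_sum m g * (\<Sum>i\<in>{0<..<m + 2}. real (vertex_degree i g) * F i)"
    unfolding sum_distrib_left by (intro sum.cong refl) (simp add: transition_prob_def)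
  finally show ?thesis .
qed

lemma sum_transition_prob:
  assumes "g \<in> reachable m"
  shows "(\<Sum>i<m + 2. transition_prob p m g i) = 1"
  using sum_transition_prob_mult[of p m g "\<lambda>_. 1"] degree_sum_pos[OF assms]
  by (simp add: flip: degree_sum_def[simplified])

lemma transition_prob_nonneg:
  "g \<in> reachable m \<Longrightarrow> 0 \<le> p \<Longrightarrow> p \<le> 1 \<Longrightarrow> 0 \<le> transition_prob p m g i"
  using degree_sum_pos[of g m] by (simp add: transition_prob_def)

text \<open>The conditional expected increment given the current graph, that is, the predictable
  part in the Doob decomposition. The statistic takes the time as an argument because the set of
  nonsuperstars grows.\<close>

definition drift :: "real \<Rightarrow> (nat \<Rightarrow> graph \<Rightarrow> real) \<Rightarrow> nat \<Rightarrow> graph \<Rightarrow> real" where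
  "drift p f m g = (\<Sum>i<m + 2. transition_prob p m g i * (f (Suc m) (attach (m + 2) i g) - f m g))"

text \<open>The increment is 1 with probability \<open>p\<close> and 2 otherwise, whatever the
  graph.\<close>

lemma drift_degree_sum:
  assumes g: "g \<in> reachable m"
  shows "drift p degree_sum m g = 2 - p"
proof -
  have "drift p degree_sum m g = (\<Sum>i<m + 2. transition_prob p m g i * (if i = 0 then 1 else 2))"
    unfolding drift_def by (intro sum.cong refl) (simp only: degree_sum_attach[OF g] lessThan_iff)
  also have "\<dots> = p + (1 - p) / degree_sum m g *
      (\<Sum>i\<in>{0<..<m + 2}. real (vertex_degree i g) * (if i = 0 then 1 else 2))"
    by (simp only: sum_transition_prob_mult) simp
  also have "(\<Sum>i\<in>{0<..<m + 2}. real (vertex_degree i g) * (if i = 0 then 1 else 2)) = degree_sum m g * 2"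
    unfolding degree_sum_def sum_distrib_right by (intro sum.cong refl) simp
  finally show ?thesis
    using degree_sum_pos[OF g] by simp
qed

text \<open>A given vertex of degree d is chosen with probability proportional to d, so class
  \<open>Suc k\<close> gains from class \<open>k\<close> and loses to the next. At
  \<open>k = 0\<close> the inflow has coefficient 0 and only new leaves enter.\<close>

lemma drift_degree_count:
  assumes g: "g \<in> reachable m"
  shows "drift p (degree_count (Suc k)) m g = of_bool (k = 0) +
    (1 - p) / degree_sum m g * (real k * degree_count k m g - real (Suc k) * degree_count (Suc k) m g)"
proof -
  let ?d = "\<lambda>j. vertex_degree j g"
  let ?F = "\<lambda>i. if i = 0 then 0 else of_bool (?d i = k) - of_bool (?d i = Suc k)"
  have "drift p (degree_count (Suc k)) m g =
      (\<Sum>i<m + 2. transition_prob p m g i * (of_bool (k = 0) + ?F i))"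
    unfolding drift_def by (intro sum.cong refl) (simp only: degree_count_attach[OF g] lessThan_iff, simp)
  also have "\<dots> = of_bool (k = 0) + (\<Sum>i<m + 2. transition_prob p m g i * ?F i)"
    using sum_transition_prob[OF g, of p]
    by (simp only: distrib_left sum.distrib flip: sum_distrib_right)
  also have "(\<Sum>i<m + 2. transition_prob p m g i * ?F i) =
      (1 - p) / degree_sum m g * (\<Sum>i\<in>{0<..<m + 2}. real (?d i) * ?F i)"
    by (simp only: sum_transition_prob_mult) simp
  also have "(\<Sum>i\<in>{0<..<m + 2}. real (?d i) * ?F i) = (\<Sum>i\<in>{0<..<m + 2}.
      real k * of_bool (?d i = k) - real (Suc k) * of_bool (?d i = Suc k))"
    \<comment> \<open>Each indicator fixes the degree, which may then be replaced by
      \<open>k\<close> or \<open>Suc k\<close>.\<close>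
    by (intro sum.cong) auto
  also have "\<dots> = real k * degree_count k m g - real (Suc k) * degree_count (Suc k) m g"
    by (simp only: degree_count_def sum_subtractf sum_distrib_left)
  finally show ?thesis by simp
qed

section \<open>The limit distribution\<close>

text \<open>The left side is the limit \<alpha> / (1 + \<beta>) that
  \<open>perturbed_linear_recursion_limit\<close> yields for class \<open>Suc k\<close>, in exactly
  the form in which it arises there.\<close>

lemma nu_SM_recursion:
  assumes p: "p < 1"
  shows "(of_bool (k = 0) + (1 - p) * (inverse (2 - p) * (real k * nu_SM k p))) /
    (1 + (1 - p) * real (Suc k) * inverse (2 - p)) = nu_SM (Suc k) p"
proof -
  define \<gamma> where "\<gamma> = (2 - p) / (1 - p)"
  have \<gamma>: "0 < \<gamma>" using p by (simp add: \<gamma>_def)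
  have "(1 - p) * inverse (2 - p) = inverse \<gamma>"
    using p by (simp add: \<gamma>_def divide_inverse)
  then have "(1 - p) * (inverse (2 - p) * x) = x / \<gamma>" "(1 - p) * x * inverse (2 - p) = x / \<gamma>" for x
    by (metis divide_inverse mult.assoc mult.commute)+
  then have "(of_bool (k = 0) + (1 - p) * (inverse (2 - p) * (real k * nu_SM k p))) /
      (1 + (1 - p) * real (Suc k) * inverse (2 - p)) =
      (of_bool (k = 0) + real k * nu_SM k p / \<gamma>) / (1 + real (Suc k) / \<gamma>)"
    by (simp only:)
  also have "\<dots> = (\<gamma> * of_bool (k = 0) + real k * nu_SM k p) / (real (Suc k) + \<gamma>)"
    using \<gamma> by (simp add: divide_simps)
  also have "\<dots> = nu_SM (Suc k) p"
  proof (cases k)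
    case (Suc j)
    then show ?thesis
      unfolding nu_SM_def \<gamma>_def[symmetric] by (simp add: divide_inverse algebra_simps)
  next
    case 0
    then show ?thesis
      unfolding nu_SM_def \<gamma>_def[symmetric] by (simp add: divide_inverse)
  qed
  finally show ?thesis .
qed

text \<open>Here \<open>t k\<close> is the mass beyond \<open>k\<close>. With \<gamma> = (2 - p) /
  (1 - p), its successive ratio is (k + 1) / (k + 1 + \<gamma>), so a fraction \<gamma> / (k + 1 +
  \<gamma>) is lost at each step.\<close>

lemma nu_SM_tail:
  fixes p :: real
  assumes p: "p < 1"
  defines "t \<equiv> \<lambda>k. fact k * (\<Prod>i = 1..k. inverse (real i + (2 - p) / (1 - p)))"
  shows "nu_SM (Suc k) p = t k - t (Suc k)"
proof -
  define \<gamma> where "\<gamma> = (2 - p) / (1 - p)"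
  have "0 < \<gamma>" using p by (simp add: \<gamma>_def)
  \<comment> \<open>Multiplying \<open>t k\<close> by this 1 gives all three terms the common factor
    \<open>q\<close>; what remains is polynomial algebra.\<close>
  then have "1 = (real (Suc k) + \<gamma>) * inverse (real (Suc k) + \<gamma>)"
    by (simp add: add_pos_pos)
  moreover define q where "q = inverse (real (Suc k) + \<gamma>)"
  ultimately have "1 = (real (Suc k) + \<gamma>) * q" by simp
  then have "t k = fact k * (\<Prod>i = 1..k. inverse (real i + \<gamma>)) * ((real (Suc k) + \<gamma>) * q)"
    by (simp add: t_def \<gamma>_def)
  moreover have "t (Suc k) = real (Suc k) * fact k * ((\<Prod>i = 1..k. inverse (real i + \<gamma>)) * q)"
    by (simp add: t_def \<gamma>_def[symmetric] q_def)
  moreover have "nu_SM (Suc k) p = \<gamma> * fact k * ((\<Prod>i = 1..k. inverse (real i + \<gamma>)) * q)"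
    by (simp add: nu_SM_def \<gamma>_def[symmetric] q_def)
  ultimately show ?thesis
    by (simp only:) (simp add: algebra_simps)
qed

lemma nu_SM_nonneg:
  assumes "p < 1"
  shows "0 \<le> nu_SM k p"
  using assms unfolding nu_SM_def by (intro mult_nonneg_nonneg prod_nonneg) auto

text \<open>The sum telescopes to \<open>t 0 = 1\<close>, because the tail \<open>t\<close> tends to
  0.\<close>

lemma nu_SM_has_sum:
  fixes p :: real
  assumes p: "p < 1"
  shows "((\<lambda>k. nu_SM k p) has_sum 1) {1..}"
proof -
  define \<gamma> where "\<gamma> = (2 - p) / (1 - p)"
  define t where "t k = fact k * (\<Prod>i = 1..k. inverse (real i + \<gamma>))" for k
  have \<gamma>: "1 \<le> \<gamma>" using p by (simp add: \<gamma>_def field_simps)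
  \<comment> \<open>As \<gamma> is at least 1, the ratio of successive tails is at most (k + 1) / (k
    + 2), and the product of these ratios collapses.\<close>
  have t_bound: "0 \<le> t k \<and> t k \<le> inverse (real (Suc k))" for k
  proof (induction k)
    case (Suc k)
    have "t (Suc k) = t k * (real (Suc k) * inverse (real (Suc k) + \<gamma>))"
      by (simp add: t_def)
    also have "\<dots> \<le> inverse (real (Suc k)) * (real (Suc k) * inverse (real (Suc k) + 1))"
      using Suc \<gamma> by (intro mult_mono le_imp_inverse_le) auto
    also have "\<dots> = inverse (real (Suc (Suc k)))" by simp
    finally have "t (Suc k) \<le> inverse (real (Suc (Suc k)))" .
    moreover have "0 \<le> t (Suc k)"
      unfolding t_def using \<gamma> by (intro mult_nonneg_nonneg prod_nonneg) auto
    ultimately show ?case by blast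
  qed (simp add: t_def)
  have "t \<longlonglongrightarrow> 0"
    by (rule tendsto_sandwich[OF _ _ tendsto_const LIMSEQ_inverse_real_of_nat]) (use t_bound in auto)
  then have "(\<lambda>k. t k - t (Suc k)) sums (t 0 - 0)"
    by (rule telescope_sums')
  then have "(\<lambda>k. nu_SM (Suc k) p) sums 1"
    using nu_SM_tail[OF p] by (simp add: t_def \<gamma>_def)
  then have "((\<lambda>k. nu_SM (Suc k) p) has_sum 1) UNIV"
    by (rule sums_nonneg_imp_has_sum) (rule nu_SM_nonneg[OF p])
  then have "((\<lambda>k. nu_SM k p) has_sum 1) (range Suc)"
    by (subst has_sum_reindex) (auto simp: o_def)
  moreover have "range Suc = {1..}"
    by (auto simp: image_iff Suc_le_eq gr0_conv_Suc)
  ultimately show ?thesis by simp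
qed

section \<open>The superstar process\<close>

context superstar_model
begin

definition H :: "nat \<Rightarrow> 'w \<Rightarrow> graph" where
  "H m = G (m + 2)"

lemma H_measurable [measurable]: "H m \<in> measurable M (count_space UNIV)"
  unfolding H_def by (rule G_measurable) simp

text \<open>Joint probabilities replace conditional ones so that graphs of probability 0 are covered
  as well: both sides are then 0.\<close>

lemma prob_transition:
  assumes g: "g \<in> reachable m" and i: "i < m + 2"
  shows "\<P>(\<omega> in M. H (Suc m) \<omega> = attach (m + 2) i g \<and> H m \<omega> = g) =
    \<P>(\<omega> in M. H m \<omega> = g) * transition_prob p m g i"
proof (cases "\<P>(\<omega> in M. H m \<omega> = g) > 0")
  case True
  have eq: "(\<Sum>j = 1..m + 2 - 1. real (vertex_degree j g)) = degree_sum m g"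
    unfolding degree_sum_def by (intro sum.cong) auto
  have "\<P>(\<omega> in M. H (Suc m) \<omega> = attach (m + 2) i g \<bar> H m \<omega> = g) = transition_prob p m g i"
  proof (cases "i = 0")
    case False
    then have "i \<in> {1..m + 2 - 1}" using i by auto
    then show ?thesis
      using attach_nonsuperstar[of "m + 2" g i] True False
      unfolding eq transition_prob_def H_def by simp
  qed (use attach_superstar[of "m + 2" g] True in \<open>simp add: transition_prob_def H_def\<close>)
  then show ?thesis
    using True by (simp add: cond_prob_def field_simps)
next
  case False
  then have zero: "\<P>(\<omega> in M. H m \<omega> = g) = 0"
    using measure_nonneg[of M] by (simp add: not_less order.antisym)
  have "\<P>(\<omega> in M. H (Suc m) \<omega> = attach (m + 2) i g \<and> H m \<omega> = g) \<le> \<P>(\<omega> in M. H m \<omega> = g)"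
    by (intro finite_measure_mono) auto
  then show ?thesis
    unfolding zero using measure_nonneg[of M] by (simp add: order.antisym)
qed

text \<open>The events for the different neighbours are disjoint, and their probabilities add up to
  that of \<open>H m = g\<close>, so the rest of this event is null.\<close>

lemma AE_attach:
  assumes g: "g \<in> reachable m"
  shows "AE \<omega> in M. H m \<omega> = g \<longrightarrow> (\<exists>i<m + 2. H (Suc m) \<omega> = attach (m + 2) i g)"
proof -
  let ?A = "\<lambda>i. {\<omega> \<in> space M. H (Suc m) \<omega> = attach (m + 2) i g \<and> H m \<omega> = g}"
  let ?B = "{\<omega> \<in> space M. H m \<omega> = g}"
  have "prob (\<Union>i<m + 2. ?A i) = (\<Sum>i<m + 2. prob (?A i))"
  proof (rule finite_measure_finite_Union)
    show "disjoint_family_on ?A {..<m + 2}"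
      unfolding disjoint_family_on_def
    proof (intro ballI impI)
      fix i j assume "i \<in> {..<m + 2}" "j \<in> {..<m + 2}" "i \<noteq> j"
      then have "attach (m + 2) i g \<noteq> attach (m + 2) j g"
        using attach_inj[OF g, of i j] by blast
      then show "?A i \<inter> ?A j = {}" by auto
    qed
  qed auto
  also have "\<dots> = (\<Sum>i<m + 2. prob ?B * transition_prob p m g i)"
    by (intro sum.cong refl prob_transition[OF g]) simp
  also have "\<dots> = prob ?B"
    unfolding sum_distrib_left[symmetric] sum_transition_prob[OF g] by simp
  finally have "prob (?B - (\<Union>i<m + 2. ?A i)) = 0"
    by (subst finite_measure_Diff) auto
  then have "AE \<omega> in M. \<omega> \<notin> ?B - (\<Union>i<m + 2. ?A i)"
    by (intro AE_not_in) (auto simp: emeasure_eq_measure intro!: null_setsI)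
  then show ?thesis
    by (rule AE_mp) auto
qed

lemma AE_reachable: "AE \<omega> in M. H m \<omega> \<in> reachable m"
proof (induction m)
  case 0
  have "H 0 \<omega> \<in> reachable 0" if "\<omega> \<in> space M" for \<omega>
    using G_2[OF that] by (simp add: H_def numeral_2_eq_2)
  then show ?case by (rule AE_I2)
next
  case (Suc m)
  have "AE \<omega> in M. \<forall>g\<in>reachable m. H m \<omega> = g \<longrightarrow> (\<exists>i<m + 2. H (Suc m) \<omega> = attach (m + 2) i g)"
    using AE_attach by (intro AE_finite_allI finite_reachable)
  with Suc show ?case
    by eventually_elim (metis reachable_attach)
qed

lemma AE_step: "AE \<omega> in M. H m \<omega> \<in> reachable m \<and> (\<exists>i<m + 2. H (Suc m) \<omega> = attach (m + 2) i (H m \<omega>))"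
proof -
  have "AE \<omega> in M. \<forall>g\<in>reachable m. H m \<omega> = g \<longrightarrow> (\<exists>i<m + 2. H (Suc m) \<omega> = attach (m + 2) i g)"
    using AE_attach by (intro AE_finite_allI finite_reachable)
  with AE_reachable[of m] show ?thesis
    by eventually_elim auto
qed

text \<open>Iterated \<open>detach\<close> recovers earlier graphs. This bridges the gap between
  conditioning on the current graph, as in the model, and the orthogonality of increments at
  different times.\<close>

lemma past_determined: "j \<le> m \<Longrightarrow> \<exists>\<phi>. AE \<omega> in M. H j \<omega> = \<phi> (H m \<omega>)"
proof (induction m)
  case 0
  then show ?case by (intro exI[of _ "\<lambda>g. g"]) simp
next
  case (Suc m)
  show ?case
  proof (cases "j = Suc m")
    case True
    then show ?thesis by (intro exI[of _ "\<lambda>g. g"]) simp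
  next
    case False
    then obtain \<phi> where "AE \<omega> in M. H j \<omega> = \<phi> (H m \<omega>)"
      using Suc by auto
    moreover have "AE \<omega> in M. H m \<omega> = detach (m + 2) (H (Suc m) \<omega>)"
      using AE_step[of m] by eventually_elim (metis detach_attach)
    ultimately have "AE \<omega> in M. H j \<omega> = \<phi> (detach (m + 2) (H (Suc m) \<omega>))"
      by eventually_elim simp
    then show ?thesis by (intro exI[of _ "\<lambda>g. \<phi> (detach (m + 2) g)"])
  qed
qed

text \<open>Outside a null set the pair of consecutive graphs takes finitely many values, so the
  expectation is a finite sum.\<close>

lemma expectation_step:
  fixes \<Phi> :: "graph \<Rightarrow> graph \<Rightarrow> real"
  assumes [measurable]: "(\<lambda>\<omega>. \<Phi> (H m \<omega>) (H (Suc m) \<omega>)) \<in> borel_measurable M"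
  shows "expectation (\<lambda>\<omega>. \<Phi> (H m \<omega>) (H (Suc m) \<omega>)) =
    (\<Sum>g\<in>reachable m. \<P>(\<omega> in M. H m \<omega> = g) *
      (\<Sum>i<m + 2. transition_prob p m g i * \<Phi> g (attach (m + 2) i g)))"
proof -
  let ?A = "\<lambda>g i. {\<omega> \<in> space M. H (Suc m) \<omega> = attach (m + 2) i g \<and> H m \<omega> = g}"
  let ?R = "\<lambda>\<omega>. \<Sum>g\<in>reachable m. \<Sum>i<m + 2. indicator (?A g i) \<omega> * \<Phi> g (attach (m + 2) i g)"
  have "expectation (\<lambda>\<omega>. \<Phi> (H m \<omega>) (H (Suc m) \<omega>)) = expectation ?R"
  proof (rule integral_cong_AE)
    show "AE \<omega> in M. \<Phi> (H m \<omega>) (H (Suc m) \<omega>) = ?R \<omega>"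
      using AE_step[of m] AE_space
    proof eventually_elim
      case (elim \<omega>)
      then obtain i where g: "H m \<omega> \<in> reachable m" and i: "i < m + 2"
        and step: "H (Suc m) \<omega> = attach (m + 2) i (H m \<omega>)" by auto
      \<comment> \<open>Exactly one indicator is nonzero at \<omega>: the one of the actual graph
        and, by \<open>attach_inj\<close>, of the actual neighbour.\<close>
      have "indicator (?A g i') \<omega> * \<Phi> g (attach (m + 2) i' g) =
          (if i' = i then if g = H m \<omega> then \<Phi> g (attach (m + 2) i g) else 0 else 0)"
        if "i' < m + 2" for g i'
      proof (cases "g = H m \<omega> \<and> i' = i")
        case False
        then have "\<omega> \<notin> ?A g i'"
          using attach_inj[OF g i that] step by auto
        then show ?thesis using False by auto
      qed (use elim(2) step in simp)
      then have "?R \<omega> = (\<Sum>g\<in>reachable m. \<Sum>i'<m + 2.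
          if i' = i then if g = H m \<omega> then \<Phi> g (attach (m + 2) i g) else 0 else 0)"
        by (intro sum.cong refl) blast
      also have "\<dots> = (\<Sum>g\<in>reachable m. if g = H m \<omega> then \<Phi> g (attach (m + 2) i g) else 0)"
        using i by (simp only: sum.delta finite_lessThan lessThan_iff if_True)
      also have "\<dots> = \<Phi> (H m \<omega>) (H (Suc m) \<omega>)"
        using g i step finite_reachable[of m] by simp
      finally show ?case by simp
    qed
    show "?R \<in> borel_measurable M" by measurable
  qed measurable
  also have "\<dots> = (\<Sum>g\<in>reachable m. \<Sum>i<m + 2. prob (?A g i) * \<Phi> g (attach (m + 2) i g))"
  proof -
    have [measurable]: "?A g i \<in> events" for g i by measurable
    have int: "integrable M (\<lambda>\<omega>. indicator (?A g i) \<omega> * x)" for g i and x :: real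
      by (intro integrable_mult_left integrable_real_indicator) (simp_all add: emeasure_eq_measure)
    have "expectation (\<lambda>\<omega>. indicator (?A g i) \<omega> * x) = prob (?A g i) * x" for g i and x :: real
      by (simp only: integral_mult_left_zero integral_indicator) (simp add: Int_absorb2 subset_iff)
    then show ?thesis
      by (simp only: Bochner_Integration.integral_sum Bochner_Integration.integrable_sum int)
  qed
  also have "\<dots> = (\<Sum>g\<in>reachable m. \<P>(\<omega> in M. H m \<omega> = g) *
      (\<Sum>i<m + 2. transition_prob p m g i * \<Phi> g (attach (m + 2) i g)))"
    unfolding sum_distrib_left
    by (intro sum.cong refl) (simp only: prob_transition lessThan_iff mult.assoc)
  finally show ?thesis .
qed

section \<open>Martingale differences of a graph statistic\<close>

definition noise :: "(nat \<Rightarrow> graph \<Rightarrow> real) \<Rightarrow> nat \<Rightarrow> 'w \<Rightarrow> real" where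
  "noise f m \<omega> = f (Suc m) (H (Suc m) \<omega>) - f m (H m \<omega>) - drift p f m (H m \<omega>)"

lemma measurable_compose_H [measurable]: "(\<lambda>\<omega>. \<phi> (H m \<omega>)) \<in> borel_measurable M"
  for \<phi> :: "graph \<Rightarrow> real"
  by (rule measurable_compose[OF H_measurable]) simp

lemma noise_measurable [measurable]: "noise f m \<in> borel_measurable M"
  using measurable_compose_H[of "f (Suc m)" "Suc m"] unfolding noise_def by measurable

text \<open>For each fixed graph the factor \<phi> is constant and the mean increment cancels the
  drift, since the transition probabilities add up to 1.\<close>

lemma noise_centered:
  fixes \<phi> :: "graph \<Rightarrow> real"
  shows "expectation (\<lambda>\<omega>. \<phi> (H m \<omega>) * noise f m \<omega>) = 0"
proof -
  let ?\<Phi> = "\<lambda>g h. \<phi> g * (f (Suc m) h - f m g - drift p f m g)"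
  have "(\<lambda>\<omega>. \<phi> (H m \<omega>) * noise f m \<omega>) \<in> borel_measurable M" by measurable
  then have "expectation (\<lambda>\<omega>. ?\<Phi> (H m \<omega>) (H (Suc m) \<omega>)) = (\<Sum>g\<in>reachable m. \<P>(\<omega> in M. H m \<omega> = g) *
      (\<Sum>i<m + 2. transition_prob p m g i * ?\<Phi> g (attach (m + 2) i g)))"
    unfolding noise_def by (rule expectation_step)
  also have "\<dots> = 0"
  proof (intro sum.neutral ballI)
    fix g assume g: "g \<in> reachable m"
    have "(\<Sum>i<m + 2. transition_prob p m g i * ?\<Phi> g (attach (m + 2) i g)) =
        (\<Sum>i<m + 2. \<phi> g * (transition_prob p m g i * (f (Suc m) (attach (m + 2) i g) - f m g))
          - \<phi> g * drift p f m g * transition_prob p m g i)"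
      by (intro sum.cong refl) (simp add: algebra_simps)
    also have "\<dots> = \<phi> g * drift p f m g - \<phi> g * drift p f m g * 1"
      unfolding sum_subtractf sum_distrib_left[symmetric] sum_transition_prob[OF g]
      by (simp only: drift_def)
    finally show "\<P>(\<omega> in M. H m \<omega> = g) *
        (\<Sum>i<m + 2. transition_prob p m g i * ?\<Phi> g (attach (m + 2) i g)) = 0"
      by simp
  qed
  finally show ?thesis unfolding noise_def .
qed

text \<open>By \<open>past_determined\<close>, the earlier noise is almost surely a function of
  \<open>H m\<close>, so \<open>noise_centered\<close> applies with that function as weight.\<close>

lemma noise_orthogonal:
  assumes "j < m"
  shows "expectation (\<lambda>\<omega>. noise f j \<omega> * noise f m \<omega>) = 0"
proof -
  obtain \<phi> \<psi> where 1: "AE \<omega> in M. H j \<omega> = \<phi> (H m \<omega>)" and 2: "AE \<omega> in M. H (Suc j) \<omega> = \<psi> (H m \<omega>)"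
    using past_determined[of j m] past_determined[of "Suc j" m] assms by auto
  define \<xi> where "\<xi> g = f (Suc j) (\<psi> g) - f j (\<phi> g) - drift p f j (\<phi> g)" for g
  have "expectation (\<lambda>\<omega>. noise f j \<omega> * noise f m \<omega>) = expectation (\<lambda>\<omega>. \<xi> (H m \<omega>) * noise f m \<omega>)"
  proof (rule integral_cong_AE)
    show "AE \<omega> in M. noise f j \<omega> * noise f m \<omega> = \<xi> (H m \<omega>) * noise f m \<omega>"
      using 1 2 by eventually_elim (simp add: noise_def \<xi>_def)
  qed measurable
  then show ?thesis by (simp only: noise_centered)
qed

text \<open>The drift is a weighted mean of increments and inherits their bound \<open>C\<close>, so
  the noise is bounded by \<open>2 * C\<close>.\<close>

lemma noise_average_tendsto_0:
  assumes incr: "\<And>m g i. g \<in> reachable m \<Longrightarrow> i < m + 2 \<Longrightarrow>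
    \<bar>f (Suc m) (attach (m + 2) i g) - f m g\<bar> \<le> C"
  shows "AE \<omega> in M. (\<lambda>n. (\<Sum>m<n. noise f m \<omega>) / real n) \<longlonglongrightarrow> 0"
proof (rule slln_bounded_orthogonal[where C = "2 * C"])
  have drift_bound: "\<bar>drift p f m g\<bar> \<le> C" if g: "g \<in> reachable m" for m g
  proof -
    have "\<bar>drift p f m g\<bar> \<le> (\<Sum>i<m + 2. \<bar>transition_prob p m g i * (f (Suc m) (attach (m + 2) i g) - f m g)\<bar>)"
      unfolding drift_def by (rule sum_abs)
    also have "\<dots> \<le> (\<Sum>i<m + 2. transition_prob p m g i * C)"
    proof (rule sum_mono)
      fix i assume "i \<in> {..<m + 2}"
      then show "\<bar>transition_prob p m g i * (f (Suc m) (attach (m + 2) i g) - f m g)\<bar>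
          \<le> transition_prob p m g i * C"
        using transition_prob_nonneg[OF g, of p i] incr[OF g, of i] p_bounds
        by (simp add: abs_mult mult_left_mono)
    qed
    also have "\<dots> = C"
      unfolding sum_distrib_right[symmetric] sum_transition_prob[OF g] by simp
    finally show ?thesis .
  qed
  show "AE \<omega> in M. \<bar>noise f m \<omega>\<bar> \<le> 2 * C" for m
    using AE_step[of m]
  proof eventually_elim
    case (elim \<omega>)
    then obtain i where "H m \<omega> \<in> reachable m" "i < m + 2" "H (Suc m) \<omega> = attach (m + 2) i (H m \<omega>)"
      by auto
    then show ?case
      using drift_bound[of "H m \<omega>" m] incr[of "H m \<omega>" m i] unfolding noise_def by simp
  qed
qed (simp_all add: noise_orthogonal)

text \<open>All exceptional null sets are discarded first; the rest is a deterministic argument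
  along one trajectory.\<close>

lemma AE_degree_count_limit:
  "AE \<omega> in M. \<forall>k. (\<lambda>m. degree_count (Suc k) m (H m \<omega>) / real m) \<longlonglongrightarrow> nu_SM (Suc k) p"
proof -
  have "AE \<omega> in M. (\<lambda>n. (\<Sum>m<n. noise degree_sum m \<omega>) / real n) \<longlonglongrightarrow> 0"
    by (rule noise_average_tendsto_0[where C = 2]) (simp only: degree_sum_attach, simp)
  moreover have "AE \<omega> in M. \<forall>k. (\<lambda>n. (\<Sum>m<n. noise (degree_count k) m \<omega>) / real n) \<longlonglongrightarrow> 0"
    unfolding AE_all_countable
    by (intro allI noise_average_tendsto_0[where C = 2]) (simp only: degree_count_attach, simp)
  moreover have "AE \<omega> in M. \<forall>m. H m \<omega> \<in> reachable m"
    unfolding AE_all_countable using AE_reachable by simp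
  ultimately show ?thesis
  proof eventually_elim
    case (elim \<omega>)
    define s where "s m = degree_sum m (H m \<omega>)" for m
    define c where "c k m = degree_count k m (H m \<omega>)" for k m
    have reach: "H m \<omega> \<in> reachable m" for m using elim(3) by simp
    have s_pos: "0 < s m" for m
      unfolding s_def by (rule degree_sum_pos[OF reach])
    \<comment> \<open>Written with a zero damping term so that the general recursion lemma applies
      with \<beta> = 0.\<close>
    have s_rec: "s (Suc m) = s m + (2 - p) - 0 * s m + noise degree_sum m \<omega>" for m
      unfolding s_def noise_def drift_degree_sum[OF reach] by simp
    have "(\<lambda>m. s m / real m) \<longlonglongrightarrow> (2 - p) / (1 + 0)"
      by (rule perturbed_linear_recursion_limit[where x = s and c = "\<lambda>_. 0", OF s_rec]) (use elim(1) in auto)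
    then have "(\<lambda>m. inverse (s m / real m)) \<longlonglongrightarrow> inverse (2 - p)"
      using p_bounds by (intro tendsto_inverse) auto
    then have s_lim: "(\<lambda>m. real m / s m) \<longlonglongrightarrow> inverse (2 - p)" by simp
    have lim_step: "(\<lambda>m. c (Suc k) m / real m) \<longlonglongrightarrow> nu_SM (Suc k) p"
      if IH: "(\<lambda>m. real k * c k m / real m) \<longlonglongrightarrow> real k * nu_SM k p" for k
    proof -
      \<comment> \<open>\<open>a\<close> collects new leaves and the inflow from class
        \<open>k\<close>; \<open>b\<close> is the outflow rate per vertex of class
        \<open>Suc k\<close>.\<close>
      define a where "a m = of_bool (k = 0) + (1 - p) * (real k * c k m / s m)" for m
      define b where "b m = (1 - p) * real (Suc k) * inverse (s m)" for m
      have c_rec: "c (Suc k) (Suc m) =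
          c (Suc k) m + a m - b m * c (Suc k) m + noise (degree_count (Suc k)) m \<omega>" for m
        unfolding s_def c_def a_def b_def noise_def drift_degree_count[OF reach]
        by (simp add: divide_inverse algebra_simps)
      have "(\<lambda>m. real m / s m * (real k * c k m / real m)) \<longlonglongrightarrow> inverse (2 - p) * (real k * nu_SM k p)"
        by (intro tendsto_mult s_lim IH)
      moreover have "\<forall>\<^sub>F m in sequentially. real m / s m * (real k * c k m / real m) = real k * c k m / s m"
        using eventually_gt_at_top[of 0] by eventually_elim simp
      ultimately have "(\<lambda>m. real k * c k m / s m) \<longlonglongrightarrow> inverse (2 - p) * (real k * nu_SM k p)"
        by (simp add: tendsto_cong)
      then have a: "a \<longlonglongrightarrow> of_bool (k = 0) + (1 - p) * (inverse (2 - p) * (real k * nu_SM k p))"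
        unfolding a_def by (intro tendsto_intros)
      have "(\<lambda>m. (1 - p) * real (Suc k) * (real m / s m)) \<longlonglongrightarrow> (1 - p) * real (Suc k) * inverse (2 - p)"
        by (intro tendsto_mult_left s_lim)
      then have b: "(\<lambda>m. real m * b m) \<longlonglongrightarrow> (1 - p) * real (Suc k) * inverse (2 - p)"
        by (simp add: b_def divide_inverse mult_ac)
      have b_nonneg: "0 \<le> b m" for m
        using p_bounds s_pos[of m] by (simp add: b_def)
      show ?thesis
        using perturbed_linear_recursion_limit[OF c_rec a b_nonneg b] elim(2)
        unfolding nu_SM_recursion[OF p_bounds(2)] by blast
    qed
    \<comment> \<open>The factor \<open>real k\<close> makes the base case trivial; the formula
      \<open>nu_SM 0 p\<close> need not be the limiting frequency of degree 0.\<close>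
    have "(\<lambda>m. real k * c k m / real m) \<longlonglongrightarrow> real k * nu_SM k p" for k
    proof (induction k)
      case (Suc k)
      show ?case
        using tendsto_mult_left[OF lim_step[OF Suc], of "real (Suc k)"] by simp
    qed simp
    then show ?case
      using lim_step unfolding c_def by blast
  qed
qed

end

theorem theorem2p2:
  fixes M :: "'w measure" and p :: real and G :: "nat \<Rightarrow> 'w \<Rightarrow> graph"
  assumes "0 < p" and "p < 1"
    and "superstar_model M p G"
  shows "((\<forall>k\<ge>1. 0 \<le> nu_SM k p) \<and> ((\<lambda>k. nu_SM k p) has_sum 1) {1..})
    \<and> (\<forall>k\<ge>1. AE \<omega> in M.
        (\<lambda>n. 1 / real n * real (card {j. 1 \<le> j \<and> j \<le> n - 1 \<and> vertex_degree j (G n \<omega>) = k}))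
          \<longlonglongrightarrow> nu_SM k p)"
proof (intro conjI allI impI)
  interpret superstar_model M p G by fact
  show "0 \<le> nu_SM k p" for k
    using nu_SM_nonneg \<open>p < 1\<close> .
  show "((\<lambda>k. nu_SM k p) has_sum 1) {1..}"
    using nu_SM_has_sum \<open>p < 1\<close> .
  fix k :: nat assume "1 \<le> k"
  then obtain l where k: "k = Suc l" by (cases k) auto
  show "AE \<omega> in M. (\<lambda>n. 1 / real n * real (card {j. 1 \<le> j \<and> j \<le> n - 1 \<and> vertex_degree j (G n \<omega>) = k}))
      \<longlonglongrightarrow> nu_SM k p"
    using AE_degree_count_limit
  proof eventually_elim
    case (elim \<omega>)
    let ?N = "\<lambda>n. real (card {j. 1 \<le> j \<and> j \<le> n - 1 \<and> vertex_degree j (G n \<omega>) = k})"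
    have N: "degree_count k m (H m \<omega>) = ?N (m + 2)" for m
      by (simp add: degree_count_eq_card H_def)
    have "(\<lambda>m. ?N (m + 2) / real m) \<longlonglongrightarrow> nu_SM k p"
      using elim unfolding k[symmetric] N[symmetric] by (simp add: k)
    \<comment> \<open>Converts the normalisation by \<open>m\<close> into the one by the number
      \<open>n = m + 2\<close> of vertices.\<close>
    moreover have "(\<lambda>m. real m / real (m + 2)) \<longlonglongrightarrow> 1"
      by real_asymp
    ultimately have "(\<lambda>m. ?N (m + 2) / real m * (real m / real (m + 2))) \<longlonglongrightarrow> nu_SM k p * 1"
      by (rule tendsto_mult)
    moreover have "\<forall>\<^sub>F m in sequentially. ?N (m + 2) / real m * (real m / real (m + 2)) = 1 / real (m + 2) * ?N (m + 2)"
      using eventually_gt_at_top[of 0] by eventually_elim simp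
    ultimately have "(\<lambda>m. 1 / real (m + 2) * ?N (m + 2)) \<longlonglongrightarrow> nu_SM k p * 1"
      by (rule Lim_transform_eventually)
    then have "(\<lambda>m. 1 / real (m + 2) * ?N (m + 2)) \<longlonglongrightarrow> nu_SM k p"
      by (simp only: mult_1_right)
    then show ?case
      by (rule LIMSEQ_offset)
  qed
qed

end
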